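(* Let $\mathcal{V}$ be the infinite $3$-graph with vertex set $\{a_i,b_i,c_i:i\in\mathbb{N}\}$ (all distinct) and edge set $\{a_ib_jc_k:i\leq j\}$, and let $\mathcal{H}_{\mathcal{V}}$ be the class of all finite $3$-graphs isomorphic to an induced sub-$3$-graph of $\mathcal{V}$. Then $\mathcal{H}_{\mathcal{V}}$ is far from slicewise stable (i.e. there is no slicewise stable hereditary $3$-graph property $\mathcal{H}'$ with $\mathcal{H}_{\mathcal{V}}\sim\mathcal{H}'$), but $\mathcal{H}_{\mathcal{V}}$ admits binary $\mathrm{vdisc}_3$-error.
   Context: For distinct $x,y,z$ write $xy=\{x,y\}$, $xyz=\{x,y,z\}$; $K_3[X,Y,Z]=\{xyz:x\in X,y\in Y,z\in Z\text{ pairwise distinct}\}$. A $3$-graph is a pair $H=(V,F)$ with $F\subseteq\binom V3$. A hereditary $3$-graph property is a class of finite $3$-graphs closed under isomorphism and induced sub-$3$-graphs. An equipartition is a partition whose parts differ in size by at most $1$. A $3$-graph $H=(V,F)$ is slicewise $k$-stable if there do not exist $a,b_1,\dots,b_k,c_1,\dots,c_k\in V$ such that for all $i,j\in\{1,\dots,k\}$, $\{a,b_i,c_j\}\in F$ if and only if $i\leq j$. A hereditary $3$-graph property is slicewise stable if there is $k$ such that each of its members is slicewise $k$-stable. Two $3$-graphs $(V,F),(V,F')$ on the same vertex set are $\delta$-close if $|F\Delta F'|\leq\delta|V|^3$. $\mathcal{H}$ is close to $\mathcal{H}'$ if for all $\delta>0$ there is $N$ such that every $G\in\mathcal{H}$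 on at least $N$ vertices is $\delta$-close to some element of $\mathcal{H}'$ with the same vertex set. $\mathcal{H}\sim\mathcal{H}'$ means $\mathcal{H}$ is close to $\mathcal{H}'$ and $\mathcal{H}'$ is close to $\mathcal{H}$. A $3$-partite $3$-graph $(U\cup V\cup W,F)$ with $|F|=d|U||V||W|$ has $\mathrm{vdisc}_3(\epsilon)$ if for all $U'\subseteq U$, $V'\subseteq V$, $W'\subseteq W$, $\big||F\cap K_3[U',V',W']|-d|U'||V'||W'|\big|\leq\epsilon|U||V||W|$. $\mathcal{H}$ admits binary $\mathrm{vdisc}_3$-error if for all $\epsilon>0$ and $t_0\geq1$ there are $T,N$ such that for every $H=(V,F)\in\mathcal{H}$ with $|V|\geq N$ there are an equipartition $\mathcal{P}$ of $V$ into $t$ parts, $t_0\leq t\leq T$, and a set $\Sigma\subseteq\binom{\mathcal{P}}{2}$ with $|\Sigma|\leq\epsilon t^2$ such that for every three distinct parts $X,Y,Z\in\mathcal{P}$ with $XY,YZ,XZ\notin\Sigma$, the $3$-graph $(X\cup Y\cup Z,F\cap K_3[X,Y,Z])$ has $\mathrm{vdisc}_3(\epsilon)$. *)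

theory Defs
  imports Complex_Main "HOL-Library.Ramsey" "HOL-Library.Disjoint_Sets" "HOL-Library.Infinite_Typeclass"
begin

type_synonym 'v graph3 = "'v set \<times> 'v set set"

abbreviation verts :: "'v graph3 \<Rightarrow> 'v set" where
  "verts G \<equiv> fst G"

abbreviation edges :: "'v graph3 \<Rightarrow> 'v set set" where
  "edges G \<equiv> snd G"

definition is_graph3 :: "'v graph3 \<Rightarrow> bool" where
  "is_graph3 G \<longleftrightarrow> edges G \<subseteq> nsets (verts G) 3"

definition K3 :: "'v set \<Rightarrow> 'v set \<Rightarrow> 'v set \<Rightarrow> 'v set set" where
  "K3 X Y Z = {{x, y, z} | x y z. x \<in> X \<and> y \<in> Y \<and> z \<in> Z \<and> x \<noteq> y \<and> y \<noteq> z \<and> x \<noteq> z}"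

definition graph3_iso :: "'u graph3 \<Rightarrow> 'v graph3 \<Rightarrow> bool" where
  "graph3_iso G G' \<longleftrightarrow>
     (\<exists>f. bij_betw f (verts G) (verts G') \<and> edges G' = (\<lambda>e. f ` e) ` edges G)"

definition induced :: "'v graph3 \<Rightarrow> 'v set \<Rightarrow> 'v graph3" where
  "induced G S = (S, {e \<in> edges G. e \<subseteq> S})"

text \<open>A class of finite 3-graphs is represented by the set of its members whose vertices lie
  in a fixed type. When that type is infinite, it contains a copy of every finite 3-graph, so
  isomorphism-closed classes are determined by this set.\<close>

definition hereditary :: "'v graph3 set \<Rightarrow> bool" where
  "hereditary \<H> \<longleftrightarrow>
     (\<forall>G\<in>\<H>. is_graph3 G \<and> finite (verts G)) \<and>
     (\<forall>G\<in>\<H>. \<forall>G'. is_graph3 G' \<and> graph3_iso G G' \<longrightarrow> G' \<in> \<H>) \<and>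
     (\<forall>G\<in>\<H>. \<forall>S\<subseteq>verts G. induced G S \<in> \<H>)"

definition slicewise_k_stable :: "nat \<Rightarrow> 'v graph3 \<Rightarrow> bool" where
  "slicewise_k_stable k G \<longleftrightarrow>
     \<not> (\<exists>a b c. a \<in> verts G \<and> (\<forall>i\<in>{1..k}. b i \<in> verts G \<and> c i \<in> verts G) \<and>
          (\<forall>i\<in>{1..k}. \<forall>j\<in>{1..k}. {a, b i, c j} \<in> edges G \<longleftrightarrow> i \<le> j))"

definition slicewise_stable :: "'v graph3 set \<Rightarrow> bool" where
  "slicewise_stable \<H> \<longleftrightarrow> (\<exists>k. \<forall>G\<in>\<H>. slicewise_k_stable k G)"

definition delta_close :: "real \<Rightarrow> 'v graph3 \<Rightarrow> 'v graph3 \<Rightarrow> bool" where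
  "delta_close \<delta> G G' \<longleftrightarrow> verts G = verts G' \<and>
     real (card ((edges G - edges G') \<union> (edges G' - edges G))) \<le> \<delta> * real (card (verts G)) ^ 3"

definition close_to :: "'v graph3 set \<Rightarrow> 'v graph3 set \<Rightarrow> bool" where
  "close_to \<H> \<H>' \<longleftrightarrow>
     (\<forall>\<delta>>0. \<exists>N::nat. \<forall>G\<in>\<H>. card (verts G) \<ge> N \<longrightarrow> (\<exists>G'\<in>\<H>'. delta_close \<delta> G G'))"

definition prop_sim :: "'v graph3 set \<Rightarrow> 'v graph3 set \<Rightarrow> bool" (infix "\<sim>\<^sub>3" 50) where
  "\<H> \<sim>\<^sub>3 \<H>' \<longleftrightarrow> close_to \<H> \<H>' \<and> close_to \<H>' \<H>"

definition far_from_slicewise_stable :: "'v graph3 set \<Rightarrow> bool" where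
  "far_from_slicewise_stable \<H> \<longleftrightarrow>
     \<not> (\<exists>\<H>'. hereditary \<H>' \<and> slicewise_stable \<H>' \<and> \<H> \<sim>\<^sub>3 \<H>')"

text \<open>Here \<open>F\<close> is the edge set of a 3-partite 3-graph with finite vertex classes \<open>U, V, W\<close>.
  If one of these is empty, then the inequality reads \<open>0 \<le> 0\<close> for every value of \<open>d\<close>, so
  the value given by division by zero does not matter.\<close>

definition vdisc3 :: "real \<Rightarrow> 'v set \<Rightarrow> 'v set \<Rightarrow> 'v set \<Rightarrow> 'v set set \<Rightarrow> bool" where
  "vdisc3 \<epsilon> U V W F \<longleftrightarrow>
     (let d = real (card F) / (real (card U) * real (card V) * real (card W)) in
      \<forall>U'\<subseteq>U. \<forall>V'\<subseteq>V. \<forall>W'\<subseteq>W.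
        \<bar>real (card (F \<inter> K3 U' V' W')) - d * real (card U') * real (card V') * real (card W')\<bar>
          \<le> \<epsilon> * real (card U) * real (card V) * real (card W))"

definition equipartition :: "'v set \<Rightarrow> 'v set set \<Rightarrow> bool" where
  "equipartition V P \<longleftrightarrow> partition_on V P \<and> (\<forall>X\<in>P. \<forall>Y\<in>P. card X \<le> card Y + 1)"

definition binary_vdisc3_error :: "'v graph3 set \<Rightarrow> bool" where
  "binary_vdisc3_error \<H> \<longleftrightarrow>
     (\<forall>\<epsilon>>0. \<forall>t0\<ge>1. \<exists>T N :: nat. \<forall>G\<in>\<H>. card (verts G) \<ge> N \<longrightarrow>
        (\<exists>P \<Sigma>. equipartition (verts G) P \<and> t0 \<le> card P \<and> card P \<le> T \<and>
           \<Sigma> \<subseteq> nsets P 2 \<and> real (card \<Sigma>) \<le> \<epsilon> * real (card P) ^ 2 \<and>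
           (\<forall>X\<in>P. \<forall>Y\<in>P. \<forall>Z\<in>P. X \<noteq> Y \<and> Y \<noteq> Z \<and> X \<noteq> Z \<and>
              {X, Y} \<notin> \<Sigma> \<and> {Y, Z} \<notin> \<Sigma> \<and> {X, Z} \<notin> \<Sigma> \<longrightarrow>
              vdisc3 \<epsilon> X Y Z (edges G \<inter> K3 X Y Z))))"

datatype V_vertex = A nat | B nat | C nat

definition V_graph :: "V_vertex graph3" where
  "V_graph = (range A \<union> range B \<union> range C, {{A i, B j, C k} | i j k. i \<le> j})"

definition H_V :: "'v graph3 set" where
  "H_V = {G. is_graph3 G \<and> finite (verts G) \<and>
             (\<exists>S\<subseteq>verts V_graph. graph3_iso (induced V_graph S) G)}"

lemma graph3_iso_trans:
  assumes "graph3_iso G G'" "graph3_iso G' G''"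
  shows "graph3_iso G G''"
proof -
  obtain f where f: "bij_betw f (verts G) (verts G')" "edges G' = (\<lambda>e. f ` e) ` edges G"
    using assms(1) unfolding graph3_iso_def by (elim exE conjE)
  obtain g where g: "bij_betw g (verts G') (verts G'')" "edges G'' = (\<lambda>e. g ` e) ` edges G'"
    using assms(2) unfolding graph3_iso_def by (elim exE conjE)
  have "bij_betw (g \<circ> f) (verts G) (verts G'')"
    using f(1) g(1) by (rule bij_betw_trans)
  moreover have "edges G'' = (\<lambda>e. (g \<circ> f) ` e) ` edges G"
    unfolding f(2) g(2) by (simp add: image_image image_comp)
  ultimately show ?thesis unfolding graph3_iso_def by blast
qed

lemma hereditary_H_V: "hereditary H_V"
  unfolding hereditary_def
proof (intro conjI ballI allI impI)
  fix G :: "'v graph3" assume "G \<in> H_V"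
  then show "is_graph3 G" "finite (verts G)" by (auto simp: H_V_def)
next
  fix G G' :: "'v graph3" assume G: "G \<in> H_V" and G': "is_graph3 G' \<and> graph3_iso G G'"
  have "finite (verts G')"
    using G G' by (auto simp: H_V_def graph3_iso_def dest: bij_betw_finite)
  moreover obtain R where "R \<subseteq> verts V_graph" "graph3_iso (induced V_graph R) G"
    using G unfolding H_V_def by blast
  moreover from this(2) have "graph3_iso (induced V_graph R) G'"
    using G' graph3_iso_trans by metis
  ultimately show "G' \<in> H_V"
    using G' unfolding H_V_def by blast
next
  fix G :: "'v graph3" and S assume G: "G \<in> H_V" and S: "S \<subseteq> verts G"
  obtain R f where R: "R \<subseteq> verts V_graph" and f: "bij_betw f R (verts G)"
    and e: "edges G = (\<lambda>e. f ` e) ` {e \<in> edges V_graph. e \<subseteq> R}"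
    using G unfolding H_V_def graph3_iso_def induced_def fst_conv snd_conv by blast
  define R' where "R' = {x \<in> R. f x \<in> S}"
  have b: "bij_betw f R' S"
  proof -
    have "inj_on f R'"
      using f unfolding bij_betw_def R'_def by (auto intro: inj_on_subset)
    moreover have "S \<subseteq> f ` R" using S bij_betw_imp_surj_on[OF f] by simp
    then have "f ` R' = S" unfolding R'_def by (auto 0 2)
    ultimately show ?thesis by (rule bij_betw_imageI)
  qed
  have "edges (induced G S) = (\<lambda>e. f ` e) ` {e \<in> edges V_graph. e \<subseteq> R'}"
    unfolding induced_def e R'_def snd_conv by blast
  with b have "graph3_iso (induced V_graph R') (induced G S)"
    unfolding graph3_iso_def induced_def fst_conv snd_conv by blast
  moreover have "R' \<subseteq> verts V_graph" using R unfolding R'_def by blast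
  moreover have "is_graph3 (induced G S)"
    using G unfolding H_V_def is_graph3_def induced_def nsets_def by fastforce
  moreover have "finite (verts (induced G S))"
    using G finite_subset[OF S] unfolding H_V_def induced_def by simp
  ultimately show "induced G S \<in> H_V" unfolding H_V_def by blast
qed

end

theory Submission
  imports Defs
begin

text \<open>Far from slicewise stable: \<open>c\<close> together with \<open>m\<close> consecutive \<open>a\<close>'s and \<open>b\<close>'s in each of
  \<open>k\<close> alternating blocks gives \<open>n m\<^sup>2\<close> half graphs of height \<open>k\<close>, where \<open>n = (2 k + 2) m\<close>. A triple
  determines at most one of them, so changing a small proportion of the \<open>n\<^sup>3\<close> triples cannot
  destroy all of them.

  Binary error: cut each of the three vertex classes into intervals. A triple of intervals is
  complete or empty unless it contains an interval meeting two classes (there are at most two of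
  these) or a pair of an \<open>a\<close>-interval and a \<open>b\<close>-interval whose index ranges interleave. Such pairs
  form a staircase, so there are only linearly many of them.\<close>

section \<open>Members of the class\<close>

text \<open>Members of the class live on an arbitrary vertex type, so a finite piece of
  \<open>V_graph\<close> is carried there by an injection, which keeps triples at size 3.\<close>

lemma H_V_image:
  fixes f :: "V_vertex \<Rightarrow> 'v"
  assumes "inj_on f S" "finite S"
  shows "(f ` S, (`) f ` edges (induced V_graph S)) \<in> H_V"
proof -
  have S: "S \<subseteq> verts V_graph"
  proof
    show "u \<in> verts V_graph" for u unfolding V_graph_def by (cases u) auto
  qed
  have "is_graph3 (f ` S, (`) f ` edges (induced V_graph S))"
    unfolding is_graph3_def
  proof
    fix e assume "e \<in> edges (f ` S, (`) f ` edges (induced V_graph S))"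
    then obtain i j k where e: "e = f ` {A i, B j, C k}" and sub: "{A i, B j, C k} \<subseteq> S"
      unfolding induced_def V_graph_def by auto
    have "card e = card {A i, B j, C k}"
      unfolding e by (rule card_image[OF inj_on_subset[OF assms(1) sub]])
    then show "e \<in> nsets (verts (f ` S, (`) f ` edges (induced V_graph S))) 3"
      using sub e by (auto simp: nsets_def)
  qed
  moreover have "graph3_iso (induced V_graph S) (f ` S, (`) f ` edges (induced V_graph S))"
    unfolding graph3_iso_def using assms(1) by (auto simp: induced_def bij_betw_def)
  ultimately show ?thesis
    using S assms(2) unfolding H_V_def by auto
qed

text \<open>An image edge might come from a triple with other indices; injectivity on
  \<open>S\<close> returns the triple itself, and the constructors then fix \<open>i\<close> and
  \<open>j\<close>.\<close>

lemma image_edge_iff: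
  assumes "inj_on f S" "{A i, B j, C k} \<subseteq> S"
  shows "f ` {A i, B j, C k} \<in> (`) f ` edges (induced V_graph S) \<longleftrightarrow> i \<le> j"
proof
  assume "f ` {A i, B j, C k} \<in> (`) f ` edges (induced V_graph S)"
  then obtain i' j' k' where eq: "f ` {A i, B j, C k} = f ` {A i', B j', C k'}"
    and sub: "{A i', B j', C k'} \<subseteq> S" and le: "i' \<le> j'"
    unfolding induced_def V_graph_def by auto
  have "{A i, B j, C k} = {A i', B j', C k'}"
    using inj_on_image_eq_iff[OF assms sub] eq by blast
  then have "i = i'" "j = j'" by auto
  then show "i \<le> j" using le by simp
next
  assume "i \<le> j"
  then show "f ` {A i, B j, C k} \<in> (`) f ` edges (induced V_graph S)"
    using assms(2) unfolding induced_def V_graph_def by (intro imageI) auto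
qed

text \<open>Inverts the isomorphism, so that edges are described by labels on \<open>G\<close>
  itself and the vertices can later be sorted by label.\<close>

lemma H_V_labelling:
  assumes "G \<in> H_V"
  obtains h where "inj_on h (verts G)"
    "edges G = {{x, y, z} | x y z i j k. x \<in> verts G \<and> y \<in> verts G \<and> z \<in> verts G \<and>
                  h x = A i \<and> h y = B j \<and> h z = C k \<and> i \<le> j}"
proof -
  obtain S f where f: "bij_betw f S (verts G)"
    and e: "edges G = (`) f ` {e \<in> edges V_graph. e \<subseteq> S}"
    using assms unfolding H_V_def graph3_iso_def induced_def fst_conv snd_conv by blast
  define h where "h = inv_into S f"
  have hf: "h (f u) = u" if "u \<in> S" for u
    unfolding h_def using f that by (simp add: bij_betw_def)
  have fh: "f (h x) = x" "h x \<in> S" if "x \<in> verts G" for x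
    using f that unfolding h_def bij_betw_def by (auto simp: f_inv_into_f inv_into_into)
  have fS: "f u \<in> verts G" if "u \<in> S" for u
    using f that unfolding bij_betw_def by blast
  have "inj_on h (verts G)"
    using fh by (metis inj_onI)
  moreover have "edges G = {{x, y, z} | x y z i j k. x \<in> verts G \<and> y \<in> verts G \<and> z \<in> verts G \<and>
                  h x = A i \<and> h y = B j \<and> h z = C k \<and> i \<le> j}" (is "_ = ?E")
  proof
    show "edges G \<subseteq> ?E"
    proof
      fix e' assume "e' \<in> edges G"
      then obtain i j k where *: "e' = f ` {A i, B j, C k}" "{A i, B j, C k} \<subseteq> S" "i \<le> j"
        unfolding e V_graph_def by auto
      then show "e' \<in> ?E"
        unfolding mem_Collect_eq
        by - (rule exI[of _ "f (A i)"], rule exI[of _ "f (B j)"], rule exI[of _ "f (C k)"],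
            auto simp: hf fS)
    qed
    show "?E \<subseteq> edges G"
    proof
      fix e' assume "e' \<in> ?E"
      then obtain x y z i j k where *: "e' = {x, y, z}" "x \<in> verts G" "y \<in> verts G"
        "z \<in> verts G" "h x = A i" "h y = B j" "h z = C k" "i \<le> j" by blast
      have "e' = f ` {A i, B j, C k}" using * fh(1) by (metis image_insert image_empty)
      have "{A i, B j, C k} \<subseteq> S" using * fh(2) by (metis empty_subsetI insert_subset)
      then have "{A i, B j, C k} \<in> {e \<in> edges V_graph. e \<subseteq> S}"
        unfolding V_graph_def using \<open>i \<le> j\<close> by auto
      then show "e' \<in> edges G" unfolding e \<open>e' = f ` {A i, B j, C k}\<close> by (rule imageI)
    qed
  qed
  ultimately show ?thesis by (rule that)
qed

section \<open>Distance from slicewise stability\<close>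

text \<open>The left index lies in the even block \<open>2 * i\<close>, the right one in the odd
  block \<open>2 * j + 1\<close>, all blocks having length \<open>m\<close>. Such blocks never
  coincide, so their numbers decide the comparison.\<close>

lemma block_index_le_iff:
  fixes s t m :: nat
  assumes "s < m" "t < m"
  shows "2 * i * m + s \<le> (2 * j + 1) * m + t \<longleftrightarrow> i \<le> j"
proof
  assume "i \<le> j"
  then have "2 * i * m \<le> 2 * j * m" by simp
  moreover have "(2 * j + 1) * m = 2 * j * m + m" by simp
  ultimately show "2 * i * m + s \<le> (2 * j + 1) * m + t" using assms by linarith
next
  assume le: "2 * i * m + s \<le> (2 * j + 1) * m + t"
  show "i \<le> j"
  proof (rule ccontr)
    assume "\<not> i \<le> j"
    then have "(2 * j + 2) * m \<le> 2 * i * m" by (intro mult_le_mono1) simp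
    with le assms show False by (simp add: algebra_simps)
  qed
qed

lemma far_from_slicewise_stable_H_V: "far_from_slicewise_stable (H_V :: 'v::infinite graph3 set)"
  unfolding far_from_slicewise_stable_def
proof
  assume "\<exists>\<H>'. hereditary \<H>' \<and> slicewise_stable \<H>' \<and> (H_V :: 'v graph3 set) \<sim>\<^sub>3 \<H>'"
  then obtain \<H>' :: "'v graph3 set" and k where h: "hereditary \<H>'"
    and st: "\<And>G. G \<in> \<H>' \<Longrightarrow> slicewise_k_stable k G" and cl: "close_to H_V \<H>'"
    unfolding slicewise_stable_def prop_sim_def by blast
  \<comment> \<open>On \<open>3 * n\<close> vertices at most \<open>27 * \<delta> * n^3\<close>
    triples change. For \<open>n = (2 * k + 2) * m\<close> this is 27/28 of the number
    \<open>m * m * n\<close> of half graphs.\<close>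
  define \<delta> :: real where "\<delta> = 1 / (28 * (2 * k + 2)^2)"
  have "\<delta> > 0" unfolding \<delta>_def by simp
  then obtain N where N: "\<And>G. G \<in> H_V \<Longrightarrow> card (verts G) \<ge> N \<Longrightarrow> \<exists>G'\<in>\<H>'. delta_close \<delta> G G'"
    using cl unfolding close_to_def by blast
  \<comment> \<open>\<open>Suc N\<close> keeps \<open>m\<close> positive and makes \<open>n\<close>
    at least \<open>N\<close>. The highest block needed below is number \<open>2 * k + 1\<close>,
    whence \<open>2 * k + 2\<close> blocks.\<close>
  define m where "m = Suc N"
  define n where "n = (2 * k + 2) * m"
  have m0: "m > 0" and n0: "n > 0" and nN: "n \<ge> N" unfolding n_def m_def by auto
  define S where "S = A ` {..<n} \<union> B ` {..<n} \<union> C ` {..<n}"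
  have "finite S" unfolding S_def by simp
  have cS: "card S = 3 * n"
  proof -
    have "card S = card (A ` {..<n} \<union> B ` {..<n}) + card (C ` {..<n})"
      unfolding S_def by (rule card_Un_disjoint) auto
    also have "card (A ` {..<n} \<union> B ` {..<n}) = card (A ` {..<n}) + card (B ` {..<n})"
      by (rule card_Un_disjoint) auto
    finally show ?thesis by (simp add: card_image inj_on_def)
  qed
  \<comment> \<open>Infinity of the vertex type provides room for a copy of
    \<open>S\<close>.\<close>
  obtain W :: "'v set" where "finite W" "card W = card S"
    using infinite_arbitrarily_large[OF infinite_UNIV] by blast
  then obtain f where f: "bij_betw f S W"
    using \<open>finite S\<close> by (metis finite_same_card_bij)
  then have inj: "inj_on f S" by (rule bij_betw_imp_inj_on)
  define G where "G = (f ` S, (`) f ` edges (induced V_graph S))"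
  have "G \<in> H_V" unfolding G_def using inj \<open>finite S\<close> by (rule H_V_image)
  moreover have cG: "card (verts G) = 3 * n"
    unfolding G_def using cS inj by (simp add: card_image)
  ultimately obtain G' where G': "G' \<in> \<H>'" and close: "delta_close \<delta> G G'"
    using N[of G] nN by auto
  have vG': "verts G' = f ` S" using close unfolding delta_close_def G_def by simp
  define D where "D = (edges G - edges G') \<union> (edges G' - edges G)"
  have cD: "real (card D) \<le> \<delta> * (3 * real n) ^ 3"
    using close cG unfolding delta_close_def D_def by simp
  \<comment> \<open>\<open>D\<close> must be shown finite: \<open>card\<close> is 0 on infinite
    sets, so a small \<open>card D\<close> alone would not limit the changed triples.\<close>
  have "is_graph3 G'" "finite (verts G')" using h G' unfolding hereditary_def by auto
  moreover have "is_graph3 G" using \<open>G \<in> H_V\<close> unfolding H_V_def by simp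
  moreover have "verts G = f ` S" unfolding G_def by simp
  ultimately have "D \<subseteq> Pow (f ` S)"
    unfolding D_def is_graph3_def nsets_def vG' by auto
  then have "finite D" using \<open>finite S\<close> by (meson finite_Pow_iff finite_imageI finite_subset)
  define E where "E i s j t c = {A (2 * i * m + s), B ((2 * j + 1) * m + t), C c}" for i s j t c :: nat
  have ES: "E i s j t c \<subseteq> S" if "i \<in> {1..k}" "j \<in> {1..k}" "s < m" "t < m" "c < n" for i s j t c
  proof -
    have "2 * i * m + s < (2 * i + 1) * m" using that by simp
    also have "\<dots> \<le> n" unfolding n_def using that by (intro mult_le_mono1) simp
    finally have a: "2 * i * m + s < n" .
    have "(2 * j + 1) * m + t < (2 * j + 2) * m" using that by simp
    also have "\<dots> \<le> n" unfolding n_def using that by (intro mult_le_mono1) simp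
    finally have b: "(2 * j + 1) * m + t < n" .
    show ?thesis unfolding E_def S_def using a b that by blast
  qed
  \<comment> \<open>With \<open>s\<close>, \<open>t\<close>, \<open>c\<close> fixed, these triples
    form a half graph of height \<open>k\<close> in the slice of \<open>G\<close> at
    \<open>f (C c)\<close>. If none were changed, it would survive in \<open>G'\<close>. For
    \<open>k = 0\<close> the vertex \<open>f (C c)\<close> alone violates stability.\<close>
  have bad: "\<exists>i\<in>{1..k}. \<exists>j\<in>{1..k}. f ` E i s j t c \<in> D" if "s < m" "t < m" "c < n" for s t c
  proof (rule ccontr)
    assume no: "\<not> ?thesis"
    have "C c \<in> S" using \<open>c < n\<close> unfolding S_def by blast
    have *: "f ` E i s j t c \<in> edges G' \<longleftrightarrow> i \<le> j" if ij: "i \<in> {1..k}" "j \<in> {1..k}" for i j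
    proof -
      have "f ` E i s j t c \<notin> D" using no ij by blast
      then have "f ` E i s j t c \<in> edges G' \<longleftrightarrow> f ` E i s j t c \<in> edges G" unfolding D_def by blast
      also have "\<dots> \<longleftrightarrow> 2 * i * m + s \<le> (2 * j + 1) * m + t"
        using ES[OF ij \<open>s < m\<close> \<open>t < m\<close> \<open>c < n\<close>] inj
        unfolding G_def E_def snd_conv by (intro image_edge_iff)
      finally show ?thesis using block_index_le_iff that \<open>s < m\<close> \<open>t < m\<close> by blast
    qed
    define b where "b i = f (A (2 * i * m + s))" for i
    define c' where "c' j = f (B ((2 * j + 1) * m + t))" for j
    have eq: "{f (C c), b i, c' j} = f ` E i s j t c" for i j
      unfolding b_def c'_def E_def by auto
    have mem: "b i \<in> verts G'" "c' i \<in> verts G'" if "i \<in> {1..k}" for i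
      using ES[OF that that \<open>s < m\<close> \<open>t < m\<close> \<open>c < n\<close>] unfolding vG' b_def c'_def E_def by auto
    have "\<not> slicewise_k_stable k G'"
      unfolding slicewise_k_stable_def not_not
      by (intro exI[of _ "f (C c)"] exI[of _ b] exI[of _ c'])
        (use mem * eq \<open>C c \<in> S\<close> vG' in auto)
    then show False using st G' by blast
  qed
  then have "\<forall>x\<in>{..<m} \<times> {..<m} \<times> {..<n}. \<exists>ij. fst ij \<in> {1..k} \<and> snd ij \<in> {1..k} \<and>
      f ` E (fst ij) (fst x) (snd ij) (fst (snd x)) (snd (snd x)) \<in> D"
    by fastforce
  then obtain g where g: "\<And>x. x \<in> {..<m} \<times> {..<m} \<times> {..<n} \<Longrightarrow>
      fst (g x) \<in> {1..k} \<and> snd (g x) \<in> {1..k} \<and>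
      f ` E (fst (g x)) (fst x) (snd (g x)) (fst (snd x)) (snd (snd x)) \<in> D"
    by metis
  define F where "F x = f ` E (fst (g x)) (fst x) (snd (g x)) (fst (snd x)) (snd (snd x))" for x
  \<comment> \<open>\<open>s\<close> and \<open>t\<close> are the residues modulo \<open>m\<close> of the indices occurring in the triple.\<close>
  have "inj_on F ({..<m} \<times> {..<m} \<times> {..<n})"
  proof (rule inj_onI)
    fix x y assume x: "x \<in> {..<m} \<times> {..<m} \<times> {..<n}" and y: "y \<in> {..<m} \<times> {..<m} \<times> {..<n}"
      and eq: "F x = F y"
    obtain s t c s' t' c' where xy: "x = (s, t, c)" "y = (s', t', c')" by (metis prod.collapse)
    obtain i j i' j' where ij: "g x = (i, j)" "g y = (i', j')" by (metis prod.collapse)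
    have lt: "s < m" "t < m" "c < n" "s' < m" "t' < m" "c' < n" using x y xy by auto
    have "E i s j t c = E i' s' j' t' c'"
    proof (rule inj_on_image_eq_iff[OF inj, THEN iffD1])
      show "E i s j t c \<subseteq> S" using g[OF x] lt ij by (intro ES) auto
      show "E i' s' j' t' c' \<subseteq> S" using g[OF y] lt ij by (intro ES) auto
      show "f ` E i s j t c = f ` E i' s' j' t' c'" using eq unfolding F_def xy(1,2) using ij xy by simp
    qed
    then have "2 * i * m + s = 2 * i' * m + s'" "(2 * j + 1) * m + t = (2 * j' + 1) * m + t'" "c = c'"
      unfolding E_def by auto
    then have "(2 * i * m + s) mod m = (2 * i' * m + s') mod m"
      "((2 * j + 1) * m + t) mod m = ((2 * j' + 1) * m + t') mod m" by (simp_all only:)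
    then have "s = s'" "t = t'" using lt by (simp_all only: mod_mult_self3 mod_less)
    then show "x = y" using xy \<open>c = c'\<close> by simp
  qed
  moreover have "F ` ({..<m} \<times> {..<m} \<times> {..<n}) \<subseteq> D" unfolding F_def using g by blast
  ultimately have "card ({..<m} \<times> {..<m} \<times> {..<n}) \<le> card D"
    using \<open>finite D\<close> by (rule card_inj_on_le)
  then have "m * m * n \<le> card D" by simp
  then have "real (m * m * n) \<le> real (card D)" by (rule of_nat_mono)
  then have "real (m * m * n) \<le> \<delta> * (3 * real n) ^ 3" using cD by linarith
  also have "\<dots> = 27 / 28 * real (m * m * n)"
  proof -
    define K :: real where "K = 2 * k + 2"
    have "K > 0" "real n = K * real m" "\<delta> = 1 / (28 * K ^ 2)"
      unfolding K_def n_def \<delta>_def by (simp_all add: algebra_simps)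
    then show ?thesis by (simp add: field_simps power2_eq_square power3_eq_cube)
  qed
  finally have "real (m * m * n) \<le> 0" by linarith
  then have "m * m * n = 0" by (simp only: of_nat_le_0_iff)
  then show False using m0 n0 by simp
qed

section \<open>Equipartitions into intervals\<close>

text \<open>The quotient is the ceiling of \<open>q * n / t\<close>; since \<open>t\<close> is
  positive, the truncated subtraction loses nothing.\<close>

lemma ceiling_mult_le_iff:
  fixes r t q n :: nat
  assumes "0 < t"
  shows "(q * n + t - 1) div t \<le> r \<longleftrightarrow> q * n \<le> r * t"
proof -
  have "(q * n + t - 1) div t \<le> r \<longleftrightarrow> (q * n + t - 1) div t < Suc r" by (rule less_Suc_eq_le[symmetric])
  also have "\<dots> \<longleftrightarrow> q * n + t - 1 < Suc r * t" using assms by (simp add: div_less_iff_less_mult)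
  also have "\<dots> \<longleftrightarrow> q * n \<le> r * t" using assms by auto
  finally show ?thesis .
qed

text \<open>The fibre runs from the ceiling of \<open>q * n / t\<close> up to, but excluding, that
  of \<open>Suc q * n / t\<close>. The numerators differ by \<open>n\<close>, so the ceilings differ
  by \<open>n div t\<close> plus a carry of at most 1.\<close>

lemma card_div_fibre:
  fixes t n q :: nat
  assumes "0 < t" "t \<le> n" "q < t"
  shows "card {r. r < n \<and> r * t div n = q} \<in> {n div t, Suc (n div t)}"
proof -
  define c where "c q = (q * n + t - 1) div t" for q
  have iff: "c q \<le> r \<longleftrightarrow> q * n \<le> r * t" for q r
    unfolding c_def using ceiling_mult_le_iff[OF assms(1)] .
  have "{r. r < n \<and> r * t div n = q} = {c q..<c (Suc q)}"
  proof (intro set_eqI)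
    fix r
    have "r * t div n = q \<longleftrightarrow> q * n \<le> r * t \<and> r * t < Suc q * n"
    proof -
      have "r * t div n = q \<longleftrightarrow> q \<le> r * t div n \<and> r * t div n < Suc q" by auto
      also have "\<dots> \<longleftrightarrow> q * n \<le> r * t \<and> r * t < Suc q * n"
        using assms less_eq_div_iff_mult_less_eq[of n q "r * t"] div_less_iff_less_mult[of n "r * t" "Suc q"]
        by simp
      finally show ?thesis .
    qed
    then have "r * t div n = q \<longleftrightarrow> c q \<le> r \<and> r < c (Suc q)"
      using iff by (metis not_le)
    \<comment> \<open>As \<open>q < t\<close>, the upper end of the interval is at most
      \<open>n\<close>, so the condition \<open>r < n\<close> does not cut it.\<close>
    moreover have "r < n" if "r < c (Suc q)"
    proof -
      have "r * t < Suc q * n" using iff that by (metis not_le)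
      also have "\<dots> \<le> t * n" using assms by (intro mult_le_mono1) simp
      finally show ?thesis by (simp add: mult.commute)
    qed
    ultimately show "r \<in> {r. r < n \<and> r * t div n = q} \<longleftrightarrow> r \<in> {c q..<c (Suc q)}" by auto
  qed
  then have card: "card {r. r < n \<and> r * t div n = q} = c (Suc q) - c q" by simp
  define a where "a = q * n + t - 1"
  have c: "c q = a div t" "c (Suc q) = (a + n) div t"
    unfolding c_def a_def using assms(1) by (simp_all add: algebra_simps)
  have "(a + n) div t = a div t + n div t + (a mod t + n mod t) div t" by (rule div_add1_eq)
  moreover have "(a mod t + n mod t) div t \<le> 1"
  proof -
    have "a mod t + n mod t < 2 * t" using assms(1) mod_less_divisor[of t a] mod_less_divisor[of t n] by linarith
    then have "(a mod t + n mod t) div t < 2" using assms(1) by (simp add: div_less_iff_less_mult)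
    then show ?thesis by simp
  qed
  ultimately show ?thesis unfolding card c by auto
qed

lemma rank_bij_betw:
  fixes key :: "'a \<Rightarrow> 'b::linorder"
  assumes "finite V" "inj_on key V"
  shows "bij_betw (\<lambda>v. card {u\<in>V. key u < key v}) V {..<card V}"
proof -
  define r where "r v = card {u\<in>V. key u < key v}" for v
  have less: "r u < r v" if "u \<in> V" "key u < key v" for u v
    unfolding r_def using that assms(1) by (intro psubset_card_mono) auto
  have "inj_on r V"
    using less assms(2) by (metis inj_onI inj_onD linorder_neqE less_irrefl)
  moreover have "r ` V \<subseteq> {..<card V}"
    unfolding r_def using assms(1) by (auto intro!: psubset_card_mono)
  ultimately have "bij_betw r V {..<card V}"
    using assms(1) by (intro bij_betw_imageI card_subset_eq) (auto simp: card_image)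
  then show ?thesis unfolding r_def .
qed

lemma interval_equipartition:
  fixes key :: "'a \<Rightarrow> 'b::linorder"
  assumes "finite V" "inj_on key V" "0 < t" "t \<le> card V"
  obtains p :: "'a \<Rightarrow> nat" where
    "\<And>u v. u \<in> V \<Longrightarrow> v \<in> V \<Longrightarrow> key u \<le> key v \<Longrightarrow> p u \<le> p v"
    "equipartition V ((\<lambda>q. {v\<in>V. p v = q}) ` {..<t})"
    "inj_on (\<lambda>q. {v\<in>V. p v = q}) {..<t}"
proof -
  define n where "n = card V"
  define r where "r v = card {u\<in>V. key u < key v}" for v
  \<comment> \<open>Scaling ranks makes every part an interval of the key order and reduces the part
    sizes to \<open>card_div_fibre\<close>.\<close>
  define p where "p v = r v * t div n" for v
  have bij: "bij_betw r V {..<n}"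
    using rank_bij_betw[OF assms(1,2)] unfolding r_def n_def .
  have mono: "p u \<le> p v" if "key u \<le> key v" for u v
  proof -
    have "r u \<le> r v" unfolding r_def using that assms(1) by (intro card_mono) auto
    then show ?thesis unfolding p_def by (intro div_le_mono mult_le_mono1)
  qed
  have pt: "p v < t" if "v \<in> V" for v
  proof -
    have "r v < n" using bij that unfolding bij_betw_def by blast
    then have "r v * t < t * n" using assms(3) by (simp add: mult.commute)
    then show ?thesis unfolding p_def by (metis less_mult_imp_div_less)
  qed
  have card: "card {v\<in>V. p v = q} \<in> {n div t, Suc (n div t)}" if "q < t" for q
  proof -
    have "bij_betw r {v\<in>V. p v = q} {x. x < n \<and> x * t div n = q}"
      using bij unfolding p_def bij_betw_def by (auto simp: inj_on_def)
    then have "card {v\<in>V. p v = q} = card {x. x < n \<and> x * t div n = q}"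
      by (rule bij_betw_same_card)
    then show ?thesis using card_div_fibre[of t n q] assms that n_def by simp
  qed
  \<comment> \<open>Here \<open>t \<le> card V\<close> enters: no part is empty, so distinct indices
    give distinct parts and there are exactly \<open>t\<close> of them.\<close>
  have "n div t > 0" using assms n_def by (simp add: div_greater_zero_iff)
  have ne: "{v\<in>V. p v = q} \<noteq> {}" if "q < t" for q
  proof -
    have "card {v\<in>V. p v = q} > 0" using card[OF that] \<open>n div t > 0\<close> by auto
    then show ?thesis by (metis card.empty less_irrefl)
  qed
  have "partition_on V ((\<lambda>q. {v\<in>V. p v = q}) ` {..<t})"
  proof (rule partition_onI)
    show "\<Union> ((\<lambda>q. {v\<in>V. p v = q}) ` {..<t}) = V" using pt by auto
  next
    fix X Y
    assume "X \<in> (\<lambda>q. {v\<in>V. p v = q}) ` {..<t}" "Y \<in> (\<lambda>q. {v\<in>V. p v = q}) ` {..<t}" "X \<noteq> Y"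
    then show "disjnt X Y" unfolding disjnt_def by auto
  qed (use ne in blast)
  moreover have "card X \<le> card Y + 1"
    if X: "X \<in> (\<lambda>q. {v\<in>V. p v = q}) ` {..<t}" and Y: "Y \<in> (\<lambda>q. {v\<in>V. p v = q}) ` {..<t}"
    for X Y
  proof -
    have "card X \<in> {n div t, Suc (n div t)}" using X card by blast
    moreover have "card Y \<in> {n div t, Suc (n div t)}" using Y card by blast
    ultimately show ?thesis by auto
  qed
  ultimately have "equipartition V ((\<lambda>q. {v\<in>V. p v = q}) ` {..<t})"
    unfolding equipartition_def by blast
  moreover have "inj_on (\<lambda>q. {v\<in>V. p v = q}) {..<t}"
  proof (rule inj_onI)
    fix q q' assume "q \<in> {..<t}" and eq: "{v\<in>V. p v = q} = {v\<in>V. p v = q'}"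
    then obtain v where "v \<in> {v\<in>V. p v = q}" using ne by blast
    moreover from this eq have "v \<in> {v\<in>V. p v = q'}" by simp
    ultimately show "q = q'" by simp
  qed
  ultimately show ?thesis using mono that by blast
qed

section \<open>Discrepancy of complete and empty triples\<close>

lemma K3_commute12: "K3 X Y Z = K3 Y X Z"
proof -
  have *: "K3 X Y Z \<subseteq> K3 Y X Z" for X Y Z :: "'a set"
  proof
    fix e assume "e \<in> K3 X Y Z"
    then obtain x y z where "e = {x, y, z}" "x \<in> X" "y \<in> Y" "z \<in> Z" "x \<noteq> y" "y \<noteq> z" "x \<noteq> z"
      unfolding K3_def by blast
    moreover from this have "e = {y, x, z}" by auto
    ultimately show "e \<in> K3 Y X Z" unfolding K3_def by blast
  qed
  show ?thesis by (rule subset_antisym) (fact *)+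
qed

lemma K3_commute23: "K3 X Y Z = K3 X Z Y"
proof -
  have *: "K3 X Y Z \<subseteq> K3 X Z Y" for X Y Z :: "'a set"
  proof
    fix e assume "e \<in> K3 X Y Z"
    then obtain x y z where "e = {x, y, z}" "x \<in> X" "y \<in> Y" "z \<in> Z" "x \<noteq> y" "y \<noteq> z" "x \<noteq> z"
      unfolding K3_def by blast
    moreover from this have "e = {x, z, y}" by auto
    ultimately show "e \<in> K3 X Z Y" unfolding K3_def by blast
  qed
  show ?thesis by (rule subset_antisym) (fact *)+
qed

text \<open>Disjointness lets the ordered triple be recovered from the set, since each element lies
  in only one of the three classes.\<close>

lemma card_K3:
  assumes "X \<inter> Y = {}" "Y \<inter> Z = {}" "X \<inter> Z = {}"
  shows "card (K3 X Y Z) = card X * card Y * card Z"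
proof -
  have "K3 X Y Z = (\<lambda>(x, y, z). {x, y, z}) ` (X \<times> Y \<times> Z)"
    unfolding K3_def using assms by (auto simp: image_iff; blast)
  moreover have "inj_on (\<lambda>(x, y, z). {x, y, z}) (X \<times> Y \<times> Z)"
  proof -
    have "x = x' \<and> y = y' \<and> z = z'"
      if *: "x \<in> X" "y \<in> Y" "z \<in> Z" "x' \<in> X" "y' \<in> Y" "z' \<in> Z" "{x, y, z} = {x', y', z'}"
      for x y z x' y' z'
    proof -
      have "x \<in> {x', y', z'}" "y \<in> {x', y', z'}" "z \<in> {x', y', z'}" using *(7) by blast+
      then show ?thesis using *(1-6) assms by blast
    qed
    then show ?thesis by (auto simp: inj_on_def)
  qed
  ultimately show ?thesis by (simp add: card_image card_cartesian_product)
qed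

lemma triple_eq_imp_permutation:
  assumes eq: "{u, v, w} = {x, y, z}" and ne: "x \<noteq> y" "y \<noteq> z" "x \<noteq> z"
  shows "u = x \<and> v = y \<and> w = z \<or> u = x \<and> v = z \<and> w = y \<or> u = y \<and> v = x \<and> w = z \<or>
    u = y \<and> v = z \<and> w = x \<or> u = z \<and> v = x \<and> w = y \<or> u = z \<and> v = y \<and> w = x"
proof -
  have "x \<in> {u, v, w}" "y \<in> {u, v, w}" "z \<in> {u, v, w}" unfolding eq by simp_all
  then show ?thesis using ne unfolding insert_iff empty_iff by (elim disjE) simp_all
qed

lemma vdisc3_empty: "\<epsilon> > 0 \<Longrightarrow> vdisc3 \<epsilon> X Y Z {}"
  unfolding vdisc3_def by simp

lemma vdisc3_K3:
  assumes "\<epsilon> > 0" "finite X" "finite Y" "finite Z"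
    and disj: "X \<inter> Y = {}" "Y \<inter> Z = {}" "X \<inter> Z = {}"
  shows "vdisc3 \<epsilon> X Y Z (K3 X Y Z)"
proof -
  define d where "d = real (card (K3 X Y Z)) / (real (card X) * real (card Y) * real (card Z))"
  have "real (card (K3 X Y Z \<inter> K3 U V W)) - d * real (card U) * real (card V) * real (card W) = 0"
    if "U \<subseteq> X" "V \<subseteq> Y" "W \<subseteq> Z" for U V W
  proof -
    have "K3 X Y Z \<inter> K3 U V W = K3 U V W" unfolding K3_def using that by blast
    moreover have "card (K3 U V W) = card U * card V * card W"
      using that disj by (intro card_K3) blast+
    \<comment> \<open>If a part is empty, division by zero gives \<open>d = 0\<close>, but then one
      of \<open>U\<close>, \<open>V\<close>, \<open>W\<close> is empty as well and both terms
      vanish.\<close>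
    moreover have "d = 1 \<or> U = {} \<or> V = {} \<or> W = {}"
      unfolding d_def card_K3[OF disj] using that assms by auto
    ultimately show ?thesis by auto
  qed
  then show ?thesis unfolding vdisc3_def Let_def d_def using assms(1) by simp
qed

section \<open>Binary error\<close>

text \<open>If the fibres of \<open>q\<close> and \<open>q'\<close> both straddle
  \<open>\<theta>\<close>, an element of the first below \<open>\<theta>\<close> precedes an element
  of the second not below it. Monotonicity gives \<open>q \<le> q'\<close>, and symmetry gives
  equality.\<close>

lemma card_threshold_fibres:
  fixes p :: "'a \<Rightarrow> nat" and key :: "'a \<Rightarrow> 'b::linorder"
  assumes mono: "\<And>u v. u \<in> V \<Longrightarrow> v \<in> V \<Longrightarrow> key u \<le> key v \<Longrightarrow> p u \<le> p v"
  shows "finite {q. \<exists>u\<in>V. \<exists>v\<in>V. p u = q \<and> p v = q \<and> key u < \<theta> \<and> \<theta> \<le> key v}"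
    and "card {q. \<exists>u\<in>V. \<exists>v\<in>V. p u = q \<and> p v = q \<and> key u < \<theta> \<and> \<theta> \<le> key v} \<le> 1"
proof -
  define Q where "Q = {q. \<exists>u\<in>V. \<exists>v\<in>V. p u = q \<and> p v = q \<and> key u < \<theta> \<and> \<theta> \<le> key v}"
  have le: "q \<le> q'" if "q \<in> Q" "q' \<in> Q" for q q'
    using that mono unfolding Q_def by (smt (verit) mem_Collect_eq less_le_trans less_imp_le)
  then have "Q \<subseteq> {q}" if "q \<in> Q" for q using that by (auto intro: antisym)
  then have "finite Q \<and> card Q \<le> 1"
    by (metis card.empty card_mono finite.emptyI finite.insertI finite_subset is_singletonI
        is_singleton_altdef all_not_in_conv zero_le)
  then show "finite {q. \<exists>u\<in>V. \<exists>v\<in>V. p u = q \<and> p v = q \<and> key u < \<theta> \<and> \<theta> \<le> key v}"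
    "card {q. \<exists>u\<in>V. \<exists>v\<in>V. p u = q \<and> p v = q \<and> key u < \<theta> \<and> \<theta> \<le> key v} \<le> 1"
    unfolding Q_def by auto
qed

fun vclass :: "V_vertex \<Rightarrow> nat" where
  "vclass (A i) = 0" | "vclass (B i) = 1" | "vclass (C i) = 2"

fun vindex :: "V_vertex \<Rightarrow> nat" where
  "vindex (A i) = i" | "vindex (B i) = i" | "vindex (C i) = i"

text \<open>For parts lying within single classes this is the only obstruction to a triple being
  complete or empty. The roles are asymmetric: \<open>X\<close> supplies the
  \<open>A\<close>-labels, \<open>Y\<close> the \<open>B\<close>-labels.\<close>

definition interleaved :: "('v \<Rightarrow> V_vertex) \<Rightarrow> 'v set \<Rightarrow> 'v set \<Rightarrow> bool" where
  "interleaved h X Y \<longleftrightarrow> (\<exists>x\<in>X. \<exists>y\<in>Y. \<exists>x'\<in>X. \<exists>y'\<in>Y. \<exists>i j i' j'.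
     h x = A i \<and> h y = B j \<and> i \<le> j \<and> h x' = A i' \<and> h y' = B j' \<and> j' < i')"

lemma card_interleaved_le:
  fixes p :: "'v \<Rightarrow> nat" and t :: nat
  assumes monoA: "\<And>u v i i'. u \<in> V \<Longrightarrow> v \<in> V \<Longrightarrow> h u = A i \<Longrightarrow> h v = A i' \<Longrightarrow> i \<le> i' \<Longrightarrow> p u \<le> p v"
    and monoB: "\<And>u v i i'. u \<in> V \<Longrightarrow> v \<in> V \<Longrightarrow> h u = B i \<Longrightarrow> h v = B i' \<Longrightarrow> i \<le> i' \<Longrightarrow> p u \<le> p v"
  shows "card {(q, q'). q < t \<and> q' < t \<and> interleaved h {v\<in>V. p v = q} {v\<in>V. p v = q'}} \<le> 2 * t"
    (is "card ?R \<le> _")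
proof -
  \<comment> \<open>The order of the intervals forces \<open>i < i'\<close> and
    \<open>j' < j\<close>, which together with \<open>j < i\<close> and \<open>i' \<le> j'\<close>
    closes a cycle.\<close>
  have no: False if q: "(q, q') \<in> ?R" and r: "(r, r') \<in> ?R" and less: "q < r" "r' < q'" for q q' r r'
  proof -
    obtain x y i j where 1: "x \<in> V" "p x = q" "y \<in> V" "p y = q'" "h x = A i" "h y = B j" "j < i"
      using q unfolding interleaved_def by auto
    obtain x' y' i' j' where 2: "x' \<in> V" "p x' = r" "y' \<in> V" "p y' = r'" "h x' = A i'" "h y' = B j'"
      "i' \<le> j'"
      using r unfolding interleaved_def by auto
    have "i < i'" using monoA[of x' x i' i] 1 2 less(1) by (meson not_le)
    moreover have "j' < j" using monoB[of y y' j j'] 1 2 less(2) by (meson not_le)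
    ultimately show False using 1 2 by linarith
  qed
  \<comment> \<open>The interleaved pairs form an increasing staircase, which meets each antidiagonal at most once.\<close>
  have "inj_on (\<lambda>(q, q'). q + q') ?R"
  proof (rule inj_onI)
    fix a b assume a: "a \<in> ?R" and b: "b \<in> ?R" and eq: "(\<lambda>(q, q'). q + q') a = (\<lambda>(q, q'). q + q') b"
    obtain q q' r r' where ab: "a = (q, q')" "b = (r, r')" by (metis prod.collapse)
    have "q + q' = r + r'" using eq ab by simp
    moreover have "\<not> (q < r \<and> r' < q')" using no a b ab by blast
    moreover have "\<not> (r < q \<and> q' < r')" using no a b ab by blast
    ultimately show "a = b" using ab by auto
  qed
  moreover have "(\<lambda>(q, q'). q + q') ` ?R \<subseteq> {..<2 * t}" by auto
  ultimately have "card ?R \<le> card {..<2 * t}" by (rule card_inj_on_le) simp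
  then show ?thesis by simp
qed

text \<open>One edge decides the whole triple: purity extends the classes of its vertices to the
  parts, and without interleaving a single \<open>i \<le> j\<close> forces all such comparisons.
  Indices of \<open>C\<close>-vertices impose nothing.\<close>

lemma complete_triple:
  assumes e: "edges G = {{x, y, z} | x y z i j k. x \<in> verts G \<and> y \<in> verts G \<and> z \<in> verts G \<and>
                  h x = A i \<and> h y = B j \<and> h z = C k \<and> i \<le> j}"
    and sub: "X \<subseteq> verts G" "Y \<subseteq> verts G" "Z \<subseteq> verts G"
    and pure: "\<And>u v. u \<in> X \<Longrightarrow> v \<in> X \<Longrightarrow> vclass (h u) = vclass (h v)"
      "\<And>u v. u \<in> Y \<Longrightarrow> v \<in> Y \<Longrightarrow> vclass (h u) = vclass (h v)"
      "\<And>u v. u \<in> Z \<Longrightarrow> v \<in> Z \<Longrightarrow> vclass (h u) = vclass (h v)"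
    and sep: "\<not> interleaved h X Y"
    and x: "x \<in> X" "h x = A i" and y: "y \<in> Y" "h y = B j" and z: "z \<in> Z" "h z = C k" and "i \<le> j"
  shows "K3 X Y Z \<subseteq> edges G"
proof
  fix f assume "f \<in> K3 X Y Z"
  then obtain u v w where f: "f = {u, v, w}" "u \<in> X" "v \<in> Y" "w \<in> Z" unfolding K3_def by blast
  obtain i' where u: "h u = A i'" using pure(1)[OF f(2) x(1)] x(2) by (cases "h u") auto
  obtain j' where v: "h v = B j'" using pure(2)[OF f(3) y(1)] y(2) by (cases "h v") auto
  obtain k' where w: "h w = C k'" using pure(3)[OF f(4) z(1)] z(2) by (cases "h w") auto
  have "i' \<le> j'"
    using sep x y \<open>i \<le> j\<close> f u v unfolding interleaved_def by (meson not_le)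
  then show "f \<in> edges G" unfolding e using f u v w sub by blast
qed

lemma binary_vdisc3_error_H_V: "binary_vdisc3_error (H_V :: 'v graph3 set)"
  unfolding binary_vdisc3_error_def
proof (intro allI impI)
  fix \<epsilon> :: real and t0 :: nat assume \<epsilon>: "\<epsilon> > 0" and t0: "1 \<le> t0"
  \<comment> \<open>At most \<open>4 * t\<close> pairs will be exceptional, and
    \<open>4 * t \<le> \<epsilon> * t^2\<close> once \<open>t\<close> is at least
    \<open>4 / \<epsilon>\<close>.\<close>
  define t where "t = max t0 (nat \<lceil>4 / \<epsilon>\<rceil>)"
  have "t0 \<le> t" "0 < t" using t0 unfolding t_def by auto
  have "4 / \<epsilon> \<le> real t" unfolding t_def by linarith
  then have t4: "4 \<le> \<epsilon> * real t" using \<epsilon> by (simp add: field_simps)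
  have main: "\<exists>P \<Sigma>. equipartition (verts G) P \<and> t0 \<le> card P \<and> card P \<le> t \<and>
           \<Sigma> \<subseteq> nsets P 2 \<and> real (card \<Sigma>) \<le> \<epsilon> * real (card P) ^ 2 \<and>
           (\<forall>X\<in>P. \<forall>Y\<in>P. \<forall>Z\<in>P. X \<noteq> Y \<and> Y \<noteq> Z \<and> X \<noteq> Z \<and>
              {X, Y} \<notin> \<Sigma> \<and> {Y, Z} \<notin> \<Sigma> \<and> {X, Z} \<notin> \<Sigma> \<longrightarrow>
              vdisc3 \<epsilon> X Y Z (edges G \<inter> K3 X Y Z))"
    if G: "G \<in> H_V" and tG: "t \<le> card (verts G)" for G :: "'v graph3"
  proof -
    define V where "V = verts G"
    have "finite V" using G unfolding H_V_def V_def by simp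
    obtain h where h: "inj_on h V"
      and e: "edges G = {{x, y, z} | x y z i j k. x \<in> verts G \<and> y \<in> verts G \<and> z \<in> verts G \<and>
                  h x = A i \<and> h y = B j \<and> h z = C k \<and> i \<le> j}"
      unfolding V_def using G by (rule H_V_labelling)
    obtain M where M: "\<And>v. v \<in> V \<Longrightarrow> vindex (h v) < M"
      using \<open>finite V\<close> finite_nat_set_iff_bounded[of "(vindex \<circ> h) ` V"] by auto
    \<comment> \<open>Lays the three classes out one after another, each sorted by index: as
      \<open>M\<close> exceeds all indices, class \<open>c\<close> occupies keys from
      \<open>c * M\<close> to below \<open>(c + 1) * M\<close>.\<close>
    define key where "key v = vclass (h v) * M + vindex (h v)" for v
    have class_le: "vclass (h v) < c \<longleftrightarrow> key v < c * M" if "v \<in> V" for v c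
    proof
      assume "vclass (h v) < c"
      then have "Suc (vclass (h v)) * M \<le> c * M" by (intro mult_le_mono1) simp
      then show "key v < c * M" using M[OF that] unfolding key_def by simp
    next
      assume "key v < c * M"
      then have "vclass (h v) * M < c * M" unfolding key_def by linarith
      then show "vclass (h v) < c" by simp
    qed
    have "inj_on key V"
    proof (rule inj_onI)
      fix u v assume uv: "u \<in> V" "v \<in> V" and eq: "key u = key v"
      have "vclass (h u) = vclass (h v)"
        using class_le[OF uv(1)] class_le[OF uv(2)] eq by (metis linorder_neqE_nat less_irrefl)
      moreover from this eq have "vindex (h u) = vindex (h v)" unfolding key_def by simp
      ultimately have "h u = h v" by (cases "h u"; cases "h v") auto
      then show "u = v" using h uv by (auto dest: inj_onD)
    qed
    have "t \<le> card V" using tG unfolding V_def .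
    obtain p :: "'v \<Rightarrow> nat" where
      mono: "\<And>u v. u \<in> V \<Longrightarrow> v \<in> V \<Longrightarrow> key u \<le> key v \<Longrightarrow> p u \<le> p v"
      and equi: "equipartition V ((\<lambda>q. {v\<in>V. p v = q}) ` {..<t})"
      and inj: "inj_on (\<lambda>q. {v\<in>V. p v = q}) {..<t}"
      by (rule interval_equipartition[OF \<open>finite V\<close> \<open>inj_on key V\<close> \<open>0 < t\<close> \<open>t \<le> card V\<close>]) blast
    define part where "part q = {v\<in>V. p v = q}" for q
    define P where "P = part ` {..<t}"
    have equi: "equipartition V P" using equi unfolding P_def part_def .
    have cP: "card P = t" unfolding P_def part_def using card_image[OF inj] by simp
    define Q where "Q \<theta> = {q. \<exists>u\<in>V. \<exists>v\<in>V. p u = q \<and> p v = q \<and> key u < \<theta> \<and> \<theta> \<le> key v}" for \<theta>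
    have Q: "finite (Q \<theta>)" "card (Q \<theta>) \<le> 1" for \<theta>
      unfolding Q_def using card_threshold_fibres[of V key p \<theta>, OF mono] by auto
    \<comment> \<open>\<open>M\<close> and \<open>2 * M\<close> are the boundaries between
      consecutive classes, so these are the at most two parts meeting several classes.\<close>
    define mixed where "mixed = Q M \<union> Q (2 * M)"
    have mixed: "finite mixed" "card mixed \<le> 2"
      unfolding mixed_def using Q[of M] Q[of "2 * M"] card_Un_le[of "Q M" "Q (2 * M)"] by auto
    have pure: "vclass (h u) \<le> vclass (h v)" if "q \<notin> mixed" "u \<in> part q" "v \<in> part q" for q u v
    proof (rule ccontr)
      assume lt: "\<not> vclass (h u) \<le> vclass (h v)"
      have uv: "u \<in> V" "v \<in> V" "p u = q" "p v = q" using that unfolding part_def by auto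
      define c where "c = vclass (h u)"
      have "\<not> vclass (h u) < c" "vclass (h v) < c" using lt unfolding c_def by auto
      then have "q \<in> Q (c * M)"
        unfolding Q_def using class_le[OF uv(1)] class_le[OF uv(2)] uv by (auto simp: not_less)
      moreover have "c = 1 \<or> c = 2"
        using lt unfolding c_def by (cases "h u"; cases "h v") auto
      ultimately show False using that(1) unfolding mixed_def by auto
    qed
    define R where "R = {(q, q'). q < t \<and> q' < t \<and> interleaved h (part q) (part q')}"
    \<comment> \<open>The mixed parts and \<open>R\<close> contribute at most \<open>2 * t\<close>
      pairs each. The intersection discards index pairs whose parts coincide.\<close>
    define \<Sigma> where "\<Sigma> = ((\<lambda>(q, q'). {part q, part q'}) ` (mixed \<times> {..<t} \<union> R)) \<inter> nsets P 2"
    have "finite R" unfolding R_def by (rule finite_subset[of _ "{..<t} \<times> {..<t}"]) auto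
    have "card R \<le> 2 * t"
      unfolding R_def part_def
    proof (rule card_interleaved_le)
      show "p u \<le> p v" if "u \<in> V" "v \<in> V" "h u = A i" "h v = A i'" "i \<le> i'" for u v i i'
        using that by (intro mono) (auto simp: key_def)
      show "p u \<le> p v" if "u \<in> V" "v \<in> V" "h u = B i" "h v = B i'" "i \<le> i'" for u v i i'
        using that by (intro mono) (auto simp: key_def)
    qed
    have "card \<Sigma> \<le> card ((\<lambda>(q, q'). {part q, part q'}) ` (mixed \<times> {..<t} \<union> R))"
      unfolding \<Sigma>_def using \<open>finite R\<close> mixed(1) by (intro card_mono) auto
    also have "\<dots> \<le> card (mixed \<times> {..<t} \<union> R)"
      using \<open>finite R\<close> mixed(1) by (intro card_image_le) auto
    also have "\<dots> \<le> card (mixed \<times> {..<t}) + card R" by (rule card_Un_le)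
    also have "\<dots> \<le> 2 * t + 2 * t"
      using mixed(2) \<open>card R \<le> 2 * t\<close> by (intro add_mono) (simp_all add: card_cartesian_product)
    finally have "real (card \<Sigma>) \<le> 4 * real t" by linarith
    also have "\<dots> \<le> (\<epsilon> * real t) * real t" using t4 by (intro mult_right_mono) auto
    finally have c\<Sigma>: "real (card \<Sigma>) \<le> \<epsilon> * real (card P) ^ 2"
      unfolding cP by (simp add: power2_eq_square)
    have in\<Sigma>: "{part q, part q'} \<in> \<Sigma>"
      if "q < t" "q' < t" "part q \<noteq> part q'"
        "q \<in> mixed \<or> q' \<in> mixed \<or> interleaved h (part q) (part q')" for q q'
    proof -
      have "{part q, part q'} \<in> nsets P 2" using that unfolding P_def nsets_def by auto
      moreover have "{part q, part q'} \<in> (\<lambda>(q, q'). {part q, part q'}) ` (mixed \<times> {..<t} \<union> R)"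
      proof -
        \<comment> \<open>The product lists the mixed index first, so a mixed \<open>q'\<close> is
          covered by the reversed pair; the unordered pair of parts is the same.\<close>
        have "(q, q') \<in> mixed \<times> {..<t} \<union> R \<or> (q', q) \<in> mixed \<times> {..<t} \<union> R"
          using that unfolding R_def by auto
        then show ?thesis by (force simp: insert_commute)
      qed
      ultimately show ?thesis unfolding \<Sigma>_def by (rule IntI[rotated])
    qed
    have complete: "K3 X Y Z \<subseteq> edges G"
      if P: "X \<in> P" "Y \<in> P" "Z \<in> P" and ne: "X \<noteq> Y" "Y \<noteq> Z" "X \<noteq> Z"
        and \<Sigma>: "{X, Y} \<notin> \<Sigma>" "{Y, Z} \<notin> \<Sigma>"
        and xyz: "x \<in> X" "h x = A i" "y \<in> Y" "h y = B j" "z \<in> Z" "h z = C k" "i \<le> j"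
      for X Y Z x y z i j k
    proof -
      have "\<exists>q<t. U = part q" if "U \<in> P" for U using that unfolding P_def by auto
      then obtain q1 q2 q3 where q: "X = part q1" "Y = part q2" "Z = part q3" "q1 < t" "q2 < t" "q3 < t"
        using P by metis
      have "\<not> (q1 \<in> mixed \<or> q2 \<in> mixed \<or> interleaved h X Y)"
        using in\<Sigma>[OF q(4,5)] \<Sigma>(1) ne(1) unfolding q(1,2) by blast
      moreover have "\<not> (q2 \<in> mixed \<or> q3 \<in> mixed \<or> interleaved h Y Z)"
        using in\<Sigma>[OF q(5,6)] \<Sigma>(2) ne(2) unfolding q(2,3) by blast
      ultimately have nm: "q1 \<notin> mixed" "q2 \<notin> mixed" "q3 \<notin> mixed" and ni: "\<not> interleaved h X Y"
        by simp_all
      show ?thesis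
      proof (rule complete_triple[OF e])
        show "X \<subseteq> verts G" "Y \<subseteq> verts G" "Z \<subseteq> verts G" unfolding q part_def V_def by auto
        show "vclass (h u) = vclass (h v)" if "u \<in> X" "v \<in> X" for u v
          using pure[OF nm(1)] that q by (simp add: antisym)
        show "vclass (h u) = vclass (h v)" if "u \<in> Y" "v \<in> Y" for u v
          using pure[OF nm(2)] that q by (simp add: antisym)
        show "vclass (h u) = vclass (h v)" if "u \<in> Z" "v \<in> Z" for u v
          using pure[OF nm(3)] that q by (simp add: antisym)
      qed (fact ni xyz)+
    qed
    have vd: "vdisc3 \<epsilon> X Y Z (edges G \<inter> K3 X Y Z)"
      if P: "X \<in> P" "Y \<in> P" "Z \<in> P" and ne: "X \<noteq> Y" "Y \<noteq> Z" "X \<noteq> Z"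
        and \<Sigma>: "{X, Y} \<notin> \<Sigma>" "{Y, Z} \<notin> \<Sigma>" "{X, Z} \<notin> \<Sigma>" for X Y Z
    \<comment> \<open>Either there is no edge and the density is 0, or one edge forces all of
      \<open>K3 X Y Z\<close> and the density is 1.\<close>
    proof (cases "edges G \<inter> K3 X Y Z = {}")
      case True
      then show ?thesis using vdisc3_empty[OF \<epsilon>] by simp
    next
      case False
      have fin: "finite X" "finite Y" "finite Z"
        using P \<open>finite V\<close> unfolding P_def part_def by auto
      have disj: "X \<inter> Y = {}" "Y \<inter> Z = {}" "X \<inter> Z = {}"
        using P ne unfolding P_def part_def by auto
      obtain f where "f \<in> edges G" "f \<in> K3 X Y Z" using False by blast
      then obtain x y z i j k where f: "f = {x, y, z}" "h x = A i" "h y = B j" "h z = C k" "i \<le> j"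
        unfolding e by blast
      obtain u v w where g: "f = {u, v, w}" "u \<in> X" "v \<in> Y" "w \<in> Z"
        using \<open>f \<in> K3 X Y Z\<close> unfolding K3_def by blast
      have ne3: "x \<noteq> y" "y \<noteq> z" "x \<noteq> z" using f by auto
      \<comment> \<open>An edge lists its vertices by class, \<open>K3\<close> by part. Each of the
        six matchings is brought to the order required by \<open>complete\<close> through the
        symmetry of \<open>K3\<close>.\<close>
      then have perm: "u = x \<and> v = y \<and> w = z \<or> u = x \<and> v = z \<and> w = y \<or> u = y \<and> v = x \<and> w = z \<or>
          u = y \<and> v = z \<and> w = x \<or> u = z \<and> v = x \<and> w = y \<or> u = z \<and> v = y \<and> w = x"
        using f(1) g(1) by (intro triple_eq_imp_permutation) simp_all
      have \<Sigma>': "{Y, X} \<notin> \<Sigma>" "{Z, Y} \<notin> \<Sigma>" "{Z, X} \<notin> \<Sigma>" using \<Sigma> by (simp_all add: insert_commute)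
      have ne': "Y \<noteq> X" "Z \<noteq> Y" "Z \<noteq> X" using ne by auto
      have *: "K3 X' Y' Z' \<subseteq> edges G"
        if "X' \<in> P" "Y' \<in> P" "Z' \<in> P" "X' \<noteq> Y'" "Y' \<noteq> Z'" "X' \<noteq> Z'"
          "{X', Y'} \<notin> \<Sigma>" "{Y', Z'} \<notin> \<Sigma>" "x \<in> X'" "y \<in> Y'" "z \<in> Z'" for X' Y' Z'
        using that(1-9) f(2) that(10) f(3) that(11) f(4,5) by (rule complete)
      have "K3 X Y Z \<subseteq> edges G"
        using perm
      proof (elim disjE conjE)
        assume "u = x" "v = y" "w = z"
        then have "x \<in> X" "y \<in> Y" "z \<in> Z" using g(2-4) by simp_all
        then have "K3 X Y Z \<subseteq> edges G" by (intro * P ne ne' \<Sigma> \<Sigma>')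
        then show ?thesis .
      next
        assume "u = x" "v = z" "w = y"
        then have "x \<in> X" "y \<in> Z" "z \<in> Y" using g(2-4) by simp_all
        then have "K3 X Z Y \<subseteq> edges G" by (intro * P ne ne' \<Sigma> \<Sigma>')
        then show ?thesis unfolding K3_commute23[of X Y Z] .
      next
        assume "u = y" "v = x" "w = z"
        then have "x \<in> Y" "y \<in> X" "z \<in> Z" using g(2-4) by simp_all
        then have "K3 Y X Z \<subseteq> edges G" by (intro * P ne ne' \<Sigma> \<Sigma>')
        then show ?thesis unfolding K3_commute12[of X Y Z] .
      next
        assume "u = y" "v = z" "w = x"
        then have "x \<in> Z" "y \<in> X" "z \<in> Y" using g(2-4) by simp_all
        then have "K3 Z X Y \<subseteq> edges G" by (intro * P ne ne' \<Sigma> \<Sigma>')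
        then show ?thesis unfolding K3_commute23[of X Y Z] K3_commute12[of X Z Y] .
      next
        assume "u = z" "v = x" "w = y"
        then have "x \<in> Y" "y \<in> Z" "z \<in> X" using g(2-4) by simp_all
        then have "K3 Y Z X \<subseteq> edges G" by (intro * P ne ne' \<Sigma> \<Sigma>')
        then show ?thesis unfolding K3_commute12[of X Y Z] K3_commute23[of Y X Z] .
      next
        assume "u = z" "v = y" "w = x"
        then have "x \<in> Z" "y \<in> Y" "z \<in> X" using g(2-4) by simp_all
        then have "K3 Z Y X \<subseteq> edges G" by (intro * P ne ne' \<Sigma> \<Sigma>')
        then show ?thesis unfolding K3_commute12[of X Y Z] K3_commute23[of Y X Z] K3_commute12[of Y Z X] .
      qed
      then have "edges G \<inter> K3 X Y Z = K3 X Y Z" by blast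
      then show ?thesis using vdisc3_K3[OF \<epsilon> fin disj] by simp
    qed
    show ?thesis
    proof (intro exI[of _ P] exI[of _ \<Sigma>] conjI)
      show "equipartition (verts G) P" using equi unfolding V_def .
      show "t0 \<le> card P" "card P \<le> t" using cP \<open>t0 \<le> t\<close> by auto
      show "\<Sigma> \<subseteq> nsets P 2" unfolding \<Sigma>_def by blast
      show "real (card \<Sigma>) \<le> \<epsilon> * real (card P) ^ 2" by (rule c\<Sigma>)
    qed (use vd in blast)
  qed
  show "\<exists>T N :: nat. \<forall>G\<in>(H_V :: 'v graph3 set). card (verts G) \<ge> N \<longrightarrow>
        (\<exists>P \<Sigma>. equipartition (verts G) P \<and> t0 \<le> card P \<and> card P \<le> T \<and>
           \<Sigma> \<subseteq> nsets P 2 \<and> real (card \<Sigma>) \<le> \<epsilon> * real (card P) ^ 2 \<and>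
           (\<forall>X\<in>P. \<forall>Y\<in>P. \<forall>Z\<in>P. X \<noteq> Y \<and> Y \<noteq> Z \<and> X \<noteq> Z \<and>
              {X, Y} \<notin> \<Sigma> \<and> {Y, Z} \<notin> \<Sigma> \<and> {X, Z} \<notin> \<Sigma> \<longrightarrow>
              vdisc3 \<epsilon> X Y Z (edges G \<inter> K3 X Y Z)))"
    \<comment> \<open>\<open>t\<close> serves as both bounds: the partition has exactly
      \<open>t\<close> parts, for which \<open>t\<close> vertices suffice.\<close>
    by (rule exI[of _ t], rule exI[of _ t]) (use main in blast)
qed

theorem proposition7p5:
  "far_from_slicewise_stable (H_V :: 'v::infinite graph3 set) \<and>
   binary_vdisc3_error (H_V :: 'v graph3 set)"
  using far_from_slicewise_stable_H_V binary_vdisc3_error_H_V by blast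

end
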